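(* Let a finite-horizon POMDP be given. Let $z^*$ be the optimal value of the mixed-integer linear program (MILP) defined in the context, let $z_{LR}^*$ be the optimal value of its linear relaxation, and let $v_{PR}^*=\max_{\delta\in\Delta_{PR}}\mathbb{E}_\delta\big[\sum_{t=1}^T r(S_t,A_t,S_{t+1})\big]$ be the optimal value of the POMDP with perfect recall. Then $$z^*\le v_{PR}^*\le z_{LR}^*.$$
   Context: Notation: $[N]=\{1,\dots,N\}$. A POMDP with horizon $T$ consists of finite nonempty sets $\mathcal{X}_S$ (states), $\mathcal{X}_O$ (observations), $\mathcal{X}_A$ (actions), an initial distribution $p(s)=\mathbb{P}(S_1=s)$, emission probabilities $p(o|s)=\mathbb{P}(O_t=o|S_t=s)$, transition probabilities $p(s'|s,a)=\mathbb{P}(S_{t+1}=s'|S_t=s,A_t=a)$ and a reward $r:\mathcal{X}_S\times\mathcal{X}_A\times\mathcal{X}_S\to\mathbb{R}$. Memoryless policies: $\Delta=\{\delta=(\delta^t_{a|o}):\ \sum_{a}\delta^t_{a|o}=1,\ \delta^t_{a|o}\ge 0\ \forall o\in\mathcal{X}_O,a\in\mathcal{X}_A,t\in[T]\}$; $\Delta^0=\{\delta\in\Delta:\ \delta^t_{a|o}\in\{0,1\}\ \forall o,a,t\}$. Perfect-recall policies: $\Delta_{PR}$ is the set of (possibly randomized) policies in which the action $A_t$ is drawn from a probability distribution on $\mathcal{X}_A$ that depends on the whole history of observations and actions $(O_1,A_1,\dots,O_{t-1},A_{t-1},O_t)$; $\Delta\subset\Delta_{PR}$. For $\delta\in\Delta_{PR}$,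 $\mathbb{E}_\delta$ is the expectation under the law given by $S_1\sim p(\cdot)$, and at each $t\in[T]$: $O_t\sim p(\cdot|S_t)$, $A_t$ drawn according to $\delta$, $S_{t+1}\sim p(\cdot|S_t,A_t)$. (MILP): over variables $\mu=\big((\mu_s^t)_s,(\mu_{sa}^t)_{s,a},(\mu_{soa}^t)_{s,o,a}\big)_t$ (with $\mu_s^t$ for $t\in[T+1]$ and the others for $t\in[T]$) and $\delta$, maximize $\sum_{t=1}^T\sum_{s,s'\in\mathcal{X}_S,\,a\in\mathcal{X}_A} r(s,a,s')\,p(s'|s,a)\,\mu_{sa}^t$ subject to, for all $s,s'\in\mathcal{X}_S$, $o\in\mathcal{X}_O$, $a\in\mathcal{X}_A$, $t\in[T]$: - $\mu_s^1=p(s)$; - $\mu_{s'}^{t+1}=\sum_{s\in\mathcal{X}_S,a\in\mathcal{X}_A}p(s'|s,a)\mu_{sa}^t$; - $\mu_{sa}^t=\sum_{o\in\mathcal{X}_O}\mu_{soa}^t$; - $\mu_{soa}^t\le p(o|s)\mu_s^t$; - $\mu_{soa}^t\le\delta^t_{a|o}$; - $\mu_{soa}^t\ge p(o|s)(\mu_s^t+\delta^t_{a|o}-1)$; - $\delta\in\Delta^0$; - $\mu\ge 0$. The linear relaxation of (MILP) is obtained by replacing $\delta\in\Delta^0$ by $\delta\in\Delta$. *)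

theory Defs
  imports "HOL-Probability.Probability"
begin

record ('s, 'o, 'a) pomdp =
  init :: "'s pmf"
  emission :: "'s \<Rightarrow> 'o pmf"
  transition :: "'s \<Rightarrow> 'a \<Rightarrow> 's pmf"
  reward :: "'s \<Rightarrow> 'a \<Rightarrow> 's \<Rightarrow> real"

subsection \<open>Memoryless policies\<close>

text \<open>The probability of taking action \<open>a\<close> on observing \<open>ob\<close> at time \<open>t\<close> is \<open>\<delta> t ob a\<close>.
  The values \<open>\<delta> t\<close> for \<open>t\<close> outside \<open>{1..T}\<close> are unconstrained and never used.\<close>

definition memoryless :: "nat \<Rightarrow> (nat \<Rightarrow> 'o \<Rightarrow> 'a::finite \<Rightarrow> real) set" where
  "memoryless T = {\<delta>. \<forall>t\<in>{1..T}. \<forall>ob. (\<Sum>a\<in>UNIV. \<delta> t ob a) = 1 \<and> (\<forall>a. \<delta> t ob a \<ge> 0)}"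

definition memoryless_det :: "nat \<Rightarrow> (nat \<Rightarrow> 'o \<Rightarrow> 'a::finite \<Rightarrow> real) set" where
  "memoryless_det T = {\<delta> \<in> memoryless T. \<forall>t\<in>{1..T}. \<forall>ob a. \<delta> t ob a \<in> {0, 1}}"

subsection \<open>Perfect-recall policies and the induced law\<close>

text \<open>The first argument of a policy is the list \<open>[(O\<^sub>1, A\<^sub>1), \<dots>, (O\<^sub>t\<^sub>-\<^sub>1, A\<^sub>t\<^sub>-\<^sub>1)]\<close>, whose length
  determines the time \<open>t\<close>; the second is the current observation \<open>O\<^sub>t\<close>.\<close>

type_synonym ('o, 'a) pr_policy = "('o \<times> 'a) list \<Rightarrow> 'o \<Rightarrow> 'a pmf"

text \<open>A trajectory \<open>([(S\<^sub>1, O\<^sub>1, A\<^sub>1), \<dots>, (S\<^sub>n, O\<^sub>n, A\<^sub>n)], S\<^sub>n\<^sub>+\<^sub>1)\<close>, in chronological order.\<close>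

type_synonym ('s, 'o, 'a) trajectory = "('s \<times> 'o \<times> 'a) list \<times> 's"

primrec law :: "('s, 'o, 'a) pomdp \<Rightarrow> ('o, 'a) pr_policy \<Rightarrow> nat \<Rightarrow> ('s, 'o, 'a) trajectory pmf" where
  "law M \<pi> 0 = map_pmf (\<lambda>s. ([], s)) (init M)"
| "law M \<pi> (Suc n) =
     bind_pmf (law M \<pi> n) (\<lambda>(h, s).
     bind_pmf (emission M s) (\<lambda>ob.
     bind_pmf (\<pi> (map snd h) ob) (\<lambda>a.
     map_pmf (\<lambda>s'. (h @ [(s, ob, a)], s')) (transition M s a))))"

text \<open>Times are counted from 1, list positions from 0.\<close>

definition state_at :: "('s, 'o, 'a) trajectory \<Rightarrow> nat \<Rightarrow> 's" where
  "state_at w t = (map fst (fst w) @ [snd w]) ! (t - 1)"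

definition action_at :: "('s, 'o, 'a) trajectory \<Rightarrow> nat \<Rightarrow> 'a" where
  "action_at w t = snd (snd (fst w ! (t - 1)))"

definition expected_reward ::
  "('s, 'o, 'a) pomdp \<Rightarrow> nat \<Rightarrow> ('o, 'a) pr_policy \<Rightarrow> real" where
  "expected_reward M T \<pi> = measure_pmf.expectation (law M \<pi> T)
     (\<lambda>w. \<Sum>t=1..T. reward M (state_at w t) (action_at w t) (state_at w (t + 1)))"

subsection \<open>The mixed-integer linear program and its relaxation\<close>

text \<open>The set \<open>D\<close> of admissible \<open>\<delta>\<close> distinguishes the two programs.  The variables are \<open>x t s\<close>
  for \<open>\<mu>\<^sup>t\<^sub>s\<close>, \<open>y t s a\<close> for \<open>\<mu>\<^sup>t\<^sub>s\<^sub>a\<close> and \<open>z t s ob a\<close> for \<open>\<mu>\<^sup>t\<^sub>s\<^sub>o\<^sub>a\<close>; time indices that the program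
  does not mention are unconstrained and do not enter the objective.\<close>

definition lp_feasible ::
  "('s::finite, 'o::finite, 'a::finite) pomdp \<Rightarrow> nat \<Rightarrow> (nat \<Rightarrow> 'o \<Rightarrow> 'a \<Rightarrow> real) set \<Rightarrow>
   (nat \<Rightarrow> 's \<Rightarrow> real) \<Rightarrow> (nat \<Rightarrow> 's \<Rightarrow> 'a \<Rightarrow> real) \<Rightarrow> (nat \<Rightarrow> 's \<Rightarrow> 'o \<Rightarrow> 'a \<Rightarrow> real) \<Rightarrow>
   (nat \<Rightarrow> 'o \<Rightarrow> 'a \<Rightarrow> real) \<Rightarrow> bool" where
  "lp_feasible M T D x y z \<delta> \<longleftrightarrow>
     (\<forall>s. x 1 s = pmf (init M) s) \<and>
     (\<forall>t\<in>{1..T}. \<forall>s'. x (t + 1) s' = (\<Sum>s\<in>UNIV. \<Sum>a\<in>UNIV. pmf (transition M s a) s' * y t s a)) \<and>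
     (\<forall>t\<in>{1..T}. \<forall>s a. y t s a = (\<Sum>ob\<in>UNIV. z t s ob a)) \<and>
     (\<forall>t\<in>{1..T}. \<forall>s ob a. z t s ob a \<le> pmf (emission M s) ob * x t s) \<and>
     (\<forall>t\<in>{1..T}. \<forall>s ob a. z t s ob a \<le> \<delta> t ob a) \<and>
     (\<forall>t\<in>{1..T}. \<forall>s ob a. z t s ob a \<ge> pmf (emission M s) ob * (x t s + \<delta> t ob a - 1)) \<and>
     \<delta> \<in> D \<and>
     (\<forall>t\<in>{1..T + 1}. \<forall>s. x t s \<ge> 0) \<and>
     (\<forall>t\<in>{1..T}. \<forall>s a. y t s a \<ge> 0) \<and>
     (\<forall>t\<in>{1..T}. \<forall>s ob a. z t s ob a \<ge> 0)"

definition lp_objective ::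
  "('s::finite, 'o, 'a::finite) pomdp \<Rightarrow> nat \<Rightarrow> (nat \<Rightarrow> 's \<Rightarrow> 'a \<Rightarrow> real) \<Rightarrow> real" where
  "lp_objective M T y =
     (\<Sum>t=1..T. \<Sum>s\<in>UNIV. \<Sum>s'\<in>UNIV. \<Sum>a\<in>UNIV.
        reward M s a s' * pmf (transition M s a) s' * y t s a)"

definition lp_values ::
  "('s::finite, 'o::finite, 'a::finite) pomdp \<Rightarrow> nat \<Rightarrow> (nat \<Rightarrow> 'o \<Rightarrow> 'a \<Rightarrow> real) set \<Rightarrow> real set" where
  "lp_values M T D = {lp_objective M T y | x y z \<delta>. lp_feasible M T D x y z \<delta>}"

subsection \<open>Optimal values\<close>

definition is_max :: "real set \<Rightarrow> real \<Rightarrow> bool" where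
  "is_max V v \<longleftrightarrow> v \<in> V \<and> (\<forall>u\<in>V. u \<le> v)"

text \<open>For real sets \<open>Sup\<close> carries information only if the set is nonempty and bounded above;
  together with \<^const>\<open>is_max\<close> it is the maximum.\<close>

definition milp_opt :: "('s::finite, 'o::finite, 'a::finite) pomdp \<Rightarrow> nat \<Rightarrow> real" where
  "milp_opt M T = Sup (lp_values M T (memoryless_det T))"

definition relaxation_opt :: "('s::finite, 'o::finite, 'a::finite) pomdp \<Rightarrow> nat \<Rightarrow> real" where
  "relaxation_opt M T = Sup (lp_values M T (memoryless T))"

definition pr_opt :: "('s::finite, 'o::finite, 'a::finite) pomdp \<Rightarrow> nat \<Rightarrow> real" where
  "pr_opt M T = Sup (range (expected_reward M T))"

end

theory Submission
  imports Defs
begin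

text \<open>
  All three optimal values are attained, and they compare because the underlying sets of values are
  nested: every value of the integer program is the expected reward of a perfect-recall policy
  (\<open>milp_values_subset\<close>), and every such expected reward is a value of the relaxation
  (\<open>pr_values_subset\<close>).

  The first inclusion is the exactness of the McCormick inequalities at \<open>\<delta> \<in> {0, 1}\<close>: they force
  \<open>\<mu>\<^sup>t\<^sub>s\<^sub>o\<^sub>a = p(o|s) \<mu>\<^sup>t\<^sub>s \<delta>\<^sup>t\<^sub>a\<^sub>|\<^sub>o\<close>, so that \<open>\<delta>\<close> determines \<open>\<mu>\<close>, which must then be the family of
  marginals of the process controlled by \<open>\<delta>\<close>.

  For the second inclusion, let a perfect-recall policy \<open>\<pi>\<close> be given, and write \<open>H\<close> for the history
  before time \<open>t\<close>. The variables \<open>\<mu>\<close> are the marginals of the controlled process, and the point is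
  to find \<open>\<delta>\<close>. The conditional probability of the action given the observation does not work in
  general: it may violate the lower McCormick inequality, since the observation carries information
  on the state. The right choice is \<open>\<delta>\<^sup>t\<^sub>a\<^sub>|\<^sub>o = E[\<pi>(a | H, o)]\<close>, in which the history keeps its
  unconditional law and \<open>o\<close> is merely plugged in. Then
  \<open>\<mu>\<^sup>t\<^sub>s\<^sub>o\<^sub>a = p(o|s) E[1(S\<^sub>t = s) \<pi>(a | H, o)]\<close>, and the McCormick inequalities are the expectations of
  \<open>u v \<le> u\<close>, \<open>u v \<le> v\<close> and \<open>u v \<ge> u + v - 1\<close> for the random numbers \<open>u = 1(S\<^sub>t = s)\<close> and
  \<open>v = \<pi>(a | H, o)\<close> in \<open>[0, 1]\<close>, weighted with \<open>p(o|s) \<le> 1\<close> (\<open>marginals_feasible\<close>).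

  The maxima exist by compactness. For both programs the variables at the relevant times are bounded,
  and those at other times may be set to zero (\<open>lp_max\<close>). Perfect-recall policies form a product of
  simplices over the countably many histories, which is compact by Tychonoff's theorem, and the
  expected reward depends continuously on the action probabilities (\<open>pr_max\<close>).
\<close>

section \<open>Expectations under the law of the process\<close>

abbreviation law_expectation ::
  "('s, 'o, 'a) pomdp \<Rightarrow> ('o, 'a) pr_policy \<Rightarrow> nat \<Rightarrow> (('s, 'o, 'a) trajectory \<Rightarrow> real) \<Rightarrow> real" where
  "law_expectation M \<pi> n g \<equiv> measure_pmf.expectation (law M \<pi> n) g"

lemma finite_set_law [simp]:
  fixes M :: "('s::finite, 'o::finite, 'a::finite) pomdp"
  shows "finite (set_pmf (law M \<pi> n))"
  by (induction n) (auto simp: split_beta)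

lemma integrable_law [simp]:
  fixes M :: "('s::finite, 'o::finite, 'a::finite) pomdp" and g :: "_ \<Rightarrow> real"
  shows "integrable (measure_pmf (law M \<pi> n)) g"
  by (rule integrable_measure_pmf_finite) simp

lemma length_history_law:
  "w \<in> set_pmf (law M \<pi> n) \<Longrightarrow> length (fst w) = n"
  by (induction n arbitrary: w) (auto simp: split_beta)

lemma law_expectation_cong:
  assumes "\<And>w. length (fst w) = n \<Longrightarrow> f w = g w"
  shows "law_expectation M \<pi> n f = law_expectation M \<pi> n g"
  by (rule integral_cong_AE) (auto simp: AE_measure_pmf_iff dest!: length_history_law intro: assms)

lemma expectation_bind_finite:
  fixes p :: "'b pmf" and f :: "'b \<Rightarrow> 'c pmf" and g :: "'c \<Rightarrow> real"
  assumes "finite (set_pmf p)" "\<And>x. finite (set_pmf (f x))"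
  shows "measure_pmf.expectation (bind_pmf p f) g =
    measure_pmf.expectation p (\<lambda>x. measure_pmf.expectation (f x) g)"
  using assms
  by (subst pmf_expectation_bind[of "set_pmf p"]) (auto simp: integral_measure_pmf[of "set_pmf p"])

lemma expectation_UNIV:
  fixes p :: "'b::finite pmf" and g :: "'b \<Rightarrow> real"
  shows "measure_pmf.expectation p g = (\<Sum>x\<in>UNIV. pmf p x * g x)"
  by (subst integral_measure_pmf[of UNIV]) auto

text \<open>Expanding the last step only. Flow constraint, accumulated reward and continuity in the policy all
  come from this recursion, each with its own payoff \<open>g\<close>.\<close>
lemma law_expectation_Suc:
  fixes M :: "('s::finite, 'o::finite, 'a::finite) pomdp"
  shows "law_expectation M \<pi> (Suc n) g = law_expectation M \<pi> n (\<lambda>w.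
    \<Sum>ob\<in>UNIV. \<Sum>a\<in>UNIV. \<Sum>s'\<in>UNIV. pmf (emission M (snd w)) ob * pmf (\<pi> (map snd (fst w)) ob) a *
      pmf (transition M (snd w) a) s' * g (fst w @ [(snd w, ob, a)], s'))"
  by (simp add: expectation_bind_finite split_beta expectation_UNIV sum_distrib_left mult.assoc)

section \<open>Marginals of the controlled process solve the relaxation\<close>

text \<open>Time \<open>t\<close> is preceded by \<open>t - 1\<close> complete steps, and the last component of such a trajectory
  is \<open>S\<^sub>t\<close>.\<close>
definition state_marginal where
  "state_marginal M \<pi> t s = law_expectation M \<pi> (t - 1) (\<lambda>w. of_bool (snd w = s))"

text \<open>The memoryless policy that answers \<open>ob\<close> as \<open>\<pi>\<close> would after a random history with its
  unconditional law; this is not the conditional law of \<open>A\<^sub>t\<close> given \<open>O\<^sub>t = ob\<close>.\<close>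
definition averaged_policy where
  "averaged_policy M \<pi> t ob a = law_expectation M \<pi> (t - 1) (\<lambda>w. pmf (\<pi> (map snd (fst w)) ob) a)"

text \<open>The probability that \<open>S\<^sub>t = s\<close>, \<open>O\<^sub>t = ob\<close> and \<open>A\<^sub>t = a\<close>: given the state, the observation is
  independent of the history, hence the factor \<open>p(o|s)\<close> in front of the expectation.\<close>
definition joint_marginal where
  "joint_marginal M \<pi> t s ob a = pmf (emission M s) ob *
     law_expectation M \<pi> (t - 1) (\<lambda>w. of_bool (snd w = s) * pmf (\<pi> (map snd (fst w)) ob) a)"

definition state_action_marginal ::
  "('s, 'o::finite, 'a) pomdp \<Rightarrow> ('o, 'a) pr_policy \<Rightarrow> nat \<Rightarrow> 's \<Rightarrow> 'a \<Rightarrow> real" where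
  "state_action_marginal M \<pi> t s a = (\<Sum>ob\<in>UNIV. joint_marginal M \<pi> t s ob a)"

lemma sum_pmf_mult:
  fixes p :: "'b::finite pmf"
  shows "(\<Sum>x\<in>UNIV. pmf p x * c) = (c::real)"
  by (simp add: sum_pmf_eq_1 flip: sum_distrib_right)

text \<open>A payoff that depends on the last transition only sees the history through the marginal of
  \<open>(S\<^sub>t, A\<^sub>t)\<close>. Rewards and indicators of the next state are the two instances that give the objective
  and the flow constraint.\<close>
lemma law_expectation_step:
  fixes M :: "('s::finite, 'o::finite, 'a::finite) pomdp" and c :: "'s \<Rightarrow> 'a \<Rightarrow> 's \<Rightarrow> real"
  shows "law_expectation M \<pi> n (\<lambda>w. \<Sum>ob\<in>UNIV. \<Sum>a\<in>UNIV. \<Sum>s'\<in>UNIV.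
      pmf (emission M (snd w)) ob * pmf (\<pi> (map snd (fst w)) ob) a *
      pmf (transition M (snd w) a) s' * c (snd w) a s') =
    (\<Sum>s\<in>UNIV. \<Sum>s'\<in>UNIV. \<Sum>a\<in>UNIV. c s a s' * pmf (transition M s a) s' *
      state_action_marginal M \<pi> (Suc n) s a)"
proof -
  have "(\<Sum>ob\<in>UNIV. \<Sum>a\<in>UNIV. \<Sum>s'\<in>UNIV.
      pmf (emission M (snd w)) ob * pmf (\<pi> (map snd (fst w)) ob) a *
      pmf (transition M (snd w) a) s' * c (snd w) a s') =
     (\<Sum>s\<in>UNIV. \<Sum>s'\<in>UNIV. \<Sum>a\<in>UNIV. \<Sum>ob\<in>UNIV. c s a s' * pmf (transition M s a) s' *
        (pmf (emission M s) ob * (of_bool (snd w = s) * pmf (\<pi> (map snd (fst w)) ob) a)))"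
    (is "?l = ?r") for w :: "('s, 'o, 'a) trajectory"
  proof -
    \<comment> \<open>The indicator of the current state collapses the sum over states; the rest is reordering.\<close>
    let ?f = "\<lambda>s s' a ob. c s a s' * pmf (transition M s a) s' *
        (pmf (emission M s) ob * pmf (\<pi> (map snd (fst w)) ob) a)"
    have "?r = (\<Sum>s\<in>UNIV. if s = snd w then \<Sum>s'\<in>UNIV. \<Sum>a\<in>UNIV. \<Sum>ob\<in>UNIV. ?f s s' a ob else 0)"
      by (intro sum.cong refl) auto
    also have "\<dots> = (\<Sum>s'\<in>UNIV. \<Sum>a\<in>UNIV. \<Sum>ob\<in>UNIV. ?f (snd w) s' a ob)"
      by simp
    also have "\<dots> = (\<Sum>ob\<in>UNIV. \<Sum>s'\<in>UNIV. \<Sum>a\<in>UNIV. ?f (snd w) s' a ob)"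
      by (subst (2) sum.swap, subst (1) sum.swap, rule refl)
    also have "\<dots> = (\<Sum>ob\<in>UNIV. \<Sum>a\<in>UNIV. \<Sum>s'\<in>UNIV. ?f (snd w) s' a ob)"
      by (intro sum.cong refl) (rule sum.swap)
    also have "\<dots> = ?l"
      by (intro sum.cong refl) (simp only: mult_ac)
    finally show ?thesis by simp
  qed
  then show ?thesis
    by (simp add: state_action_marginal_def joint_marginal_def sum_distrib_left)
qed

lemma state_marginal_Suc:
  fixes M :: "('s::finite, 'o::finite, 'a::finite) pomdp"
  shows "state_marginal M \<pi> (Suc (Suc n)) s' =
    (\<Sum>s\<in>UNIV. \<Sum>a\<in>UNIV. pmf (transition M s a) s' * state_action_marginal M \<pi> (Suc n) s a)"
proof -
  have "state_marginal M \<pi> (Suc (Suc n)) s' =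
     (\<Sum>s\<in>UNIV. \<Sum>s''\<in>UNIV. \<Sum>a\<in>UNIV. of_bool (s'' = s') * pmf (transition M s a) s'' *
      state_action_marginal M \<pi> (Suc n) s a)"
    unfolding state_marginal_def
    by (simp only: law_expectation_Suc diff_Suc_1 snd_conv
        law_expectation_step[where c = "\<lambda>s a s''. of_bool (s'' = s')"])
  also have "\<dots> = (\<Sum>s\<in>UNIV. \<Sum>s''\<in>UNIV. if s'' = s' then \<Sum>a\<in>UNIV. pmf (transition M s a) s'' *
      state_action_marginal M \<pi> (Suc n) s a else 0)"
    by (intro sum.cong refl) auto
  finally show ?thesis by simp
qed

text \<open>The total reward up to time \<open>T\<close> is not itself a function of the last transition, but extending a
  trajectory leaves the earlier rewards unchanged and adds one term that is.\<close>
lemma expected_reward_eq_lp_objective: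
  fixes M :: "('s::finite, 'o::finite, 'a::finite) pomdp"
  shows "expected_reward M T \<pi> = lp_objective M T (state_action_marginal M \<pi>)"
proof (induction T)
  case 0
  show ?case by (simp add: expected_reward_def lp_objective_def)
next
  case (Suc n)
  let ?R = "\<lambda>n w. \<Sum>t=1..n. reward M (state_at w t) (action_at w t) (state_at w (t + 1))"
  have R: "?R (Suc n) (fst w @ [(snd w, ob, a)], s') = ?R n w + reward M (snd w) a s'"
    if "length (fst w) = n" for w :: "('s, 'o, 'a) trajectory" and ob a s'
    using that by (auto simp: state_at_def action_at_def nth_append intro!: sum.cong)
  \<comment> \<open>Rewards of the past are constant in the new step, whose probabilities sum to one.\<close>
  have total: "(\<Sum>ob\<in>UNIV. \<Sum>a\<in>UNIV. \<Sum>s'\<in>UNIV. pmf (emission M s) ob * pmf (\<pi> h ob) a *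
      pmf (transition M s a) s' * r) = r" for s h r
    by (simp add: mult.assoc sum_pmf_mult flip: sum_distrib_left)
  have "expected_reward M (Suc n) \<pi> = law_expectation M \<pi> n (\<lambda>w.
      ?R n w + (\<Sum>ob\<in>UNIV. \<Sum>a\<in>UNIV. \<Sum>s'\<in>UNIV. pmf (emission M (snd w)) ob *
        pmf (\<pi> (map snd (fst w)) ob) a * pmf (transition M (snd w) a) s' * reward M (snd w) a s'))"
    unfolding expected_reward_def law_expectation_Suc
    by (intro law_expectation_cong) (simp only: R distrib_left sum.distrib total)
  also have "\<dots> = expected_reward M n \<pi> + (\<Sum>s\<in>UNIV. \<Sum>s'\<in>UNIV. \<Sum>a\<in>UNIV.
      reward M s a s' * pmf (transition M s a) s' * state_action_marginal M \<pi> (Suc n) s a)"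
    by (subst Bochner_Integration.integral_add)
      (simp_all only: integrable_law law_expectation_step expected_reward_def)
  finally show ?case
    using Suc.IH by (simp add: lp_objective_def)
qed

lemma averaged_policy_memoryless:
  fixes M :: "('s::finite, 'o::finite, 'a::finite) pomdp"
  shows "averaged_policy M \<pi> \<in> memoryless T"
proof -
  have "(\<Sum>a\<in>UNIV. averaged_policy M \<pi> t ob a) = 1" for t ob
    by (simp add: averaged_policy_def sum_pmf_eq_1 flip: Bochner_Integration.integral_sum)
  then show ?thesis
    by (auto simp: memoryless_def averaged_policy_def intro!: Bochner_Integration.integral_nonneg)
qed

text \<open>The McCormick inequalities hold pointwise, for the product of the indicator of the state and
  the action probability after the history, and expectation preserves them. This applies because
  \<open>averaged_policy\<close> and \<open>state_marginal\<close> are expectations over the same unconditioned history.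
  The set \<open>D\<close> is a parameter because policies that play a constant action also give a feasible point
  of the integer program.\<close>
lemma marginals_feasible:
  fixes M :: "('s::finite, 'o::finite, 'a::finite) pomdp"
  assumes "averaged_policy M \<pi> \<in> D"
  shows "lp_feasible M T D (state_marginal M \<pi>) (state_action_marginal M \<pi>)
    (joint_marginal M \<pi>) (averaged_policy M \<pi>)"
proof -
  let ?x = "state_marginal M \<pi>" and ?y = "state_action_marginal M \<pi>"
    and ?z = "joint_marginal M \<pi>" and ?d = "averaged_policy M \<pi>"
  have init: "?x 1 s = pmf (init M) s" for s
    by (simp add: state_marginal_def expectation_UNIV)
  have flow: "?x (t + 1) s' = (\<Sum>s\<in>UNIV. \<Sum>a\<in>UNIV. pmf (transition M s a) s' * ?y t s a)"
    if "t \<in> {1..T}" for t s'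
    using that state_marginal_Suc[of M \<pi> "t - 1" s'] by simp
  have z_state: "?z t s ob a \<le> pmf (emission M s) ob * ?x t s" for t s ob a
    unfolding joint_marginal_def state_marginal_def
    by (intro mult_left_mono Bochner_Integration.integral_mono) (auto simp: pmf_le_1)
  have z_nonneg: "?z t s ob a \<ge> 0" for t s ob a
    unfolding joint_marginal_def by (intro mult_nonneg_nonneg Bochner_Integration.integral_nonneg) auto
  have z_action: "?z t s ob a \<le> ?d t ob a" for t s ob a
  proof -
    have "?z t s ob a \<le> 1 * law_expectation M \<pi> (t - 1)
        (\<lambda>w. of_bool (snd w = s) * pmf (\<pi> (map snd (fst w)) ob) a)"
      unfolding joint_marginal_def by (intro mult_right_mono Bochner_Integration.integral_nonneg)
        (auto simp: pmf_le_1)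
    also have "\<dots> \<le> ?d t ob a"
      unfolding averaged_policy_def mult_1 by (intro Bochner_Integration.integral_mono) auto
    finally show ?thesis .
  qed
  \<comment> \<open>An indicator \<open>u\<close> and a number \<open>v \<le> 1\<close> satisfy \<open>u + v - 1 \<le> u v\<close>.\<close>
  have z_lower: "?z t s ob a \<ge> pmf (emission M s) ob * (?x t s + ?d t ob a - 1)" for t s ob a
  proof -
    have "?x t s + ?d t ob a - 1 = law_expectation M \<pi> (t - 1)
        (\<lambda>w. of_bool (snd w = s) + pmf (\<pi> (map snd (fst w)) ob) a - 1)"
      unfolding state_marginal_def averaged_policy_def by simp
    also have "\<dots> \<le> law_expectation M \<pi> (t - 1)
        (\<lambda>w. of_bool (snd w = s) * pmf (\<pi> (map snd (fst w)) ob) a)"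
      by (intro Bochner_Integration.integral_mono) (auto simp: pmf_le_1)
    finally show ?thesis
      unfolding joint_marginal_def by (intro mult_left_mono) auto
  qed
  have x_nonneg: "?x t s \<ge> 0" for t s
    unfolding state_marginal_def by (intro Bochner_Integration.integral_nonneg) auto
  have y_nonneg: "?y t s a \<ge> 0" for t s a
    unfolding state_action_marginal_def by (intro sum_nonneg z_nonneg)
  show ?thesis
    unfolding lp_feasible_def
    using assms init flow z_state z_action z_lower z_nonneg x_nonneg y_nonneg
    by (auto simp: state_action_marginal_def)
qed

section \<open>Solutions of the integer program come from policies\<close>

definition stochastic :: "('a::finite \<Rightarrow> real) \<Rightarrow> bool" where
  "stochastic p \<longleftrightarrow> (\<forall>a. 0 \<le> p a) \<and> (\<Sum>a\<in>UNIV. p a) = 1"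

lemma pmf_embed_stochastic: "stochastic p \<Longrightarrow> pmf (embed_pmf p) a = p a"
  unfolding stochastic_def
  by (intro pmf_embed_pmf) (auto simp: nn_integral_count_space_finite)

text \<open>Only the length of the history matters: it encodes the time. At times where \<open>\<delta>\<close> is not
  stochastic the value is some unspecified distribution.\<close>
definition memoryless_policy :: "(nat \<Rightarrow> 'o \<Rightarrow> 'a::finite \<Rightarrow> real) \<Rightarrow> ('o, 'a) pr_policy" where
  "memoryless_policy \<delta> h ob = embed_pmf (\<delta> (length h + 1) ob)"

text \<open>For a memoryless policy the action probability is constant over the histories and leaves the
  expectation, so that the bilinear identity linearised by the program holds exactly.\<close>
lemma joint_marginal_memoryless:
  fixes M :: "('s::finite, 'o::finite, 'a::finite) pomdp"
  assumes "\<delta> \<in> memoryless T" "t \<in> {1..T}"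
  shows "joint_marginal M (memoryless_policy \<delta>) t s ob a =
    pmf (emission M s) ob * state_marginal M (memoryless_policy \<delta>) t s * \<delta> t ob a"
proof -
  have "stochastic (\<delta> t ob)"
    using assms by (auto simp: memoryless_def stochastic_def)
  then have "law_expectation M (memoryless_policy \<delta>) (t - 1)
      (\<lambda>w. of_bool (snd w = s) * pmf (memoryless_policy \<delta> (map snd (fst w)) ob) a) =
    law_expectation M (memoryless_policy \<delta>) (t - 1) (\<lambda>w. of_bool (snd w = s) * \<delta> t ob a)"
    using assms(2)
    by (intro law_expectation_cong) (simp add: memoryless_policy_def pmf_embed_stochastic)
  then show ?thesis
    by (simp add: joint_marginal_def state_marginal_def)
qed

text \<open>With \<open>\<delta> \<in> {0, 1}\<close> the McCormick inequalities leave \<open>\<mu>\<^sup>t\<^sub>s\<^sub>o\<^sub>a\<close> no freedom, and the flow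
  constraint then propagates the identity with the marginals from the initial law to all times.\<close>
lemma det_feasible_eq_marginals:
  fixes M :: "('s::finite, 'o::finite, 'a::finite) pomdp"
  assumes feas: "lp_feasible M T (memoryless_det T) x y z \<delta>" and "t \<in> {1..T}"
  shows "y t s a = state_action_marginal M (memoryless_policy \<delta>) t s a"
proof -
  let ?\<pi> = "memoryless_policy \<delta>"
  have \<delta>: "\<delta> \<in> memoryless T"
    using feas by (auto simp: lp_feasible_def memoryless_det_def)
  have z: "z t s ob a = pmf (emission M s) ob * x t s * \<delta> t ob a"
    if "t \<in> {1..T}" for t s ob a
  proof -
    have bounds: "z t s ob a \<le> pmf (emission M s) ob * x t s" "z t s ob a \<le> \<delta> t ob a"
      "z t s ob a \<ge> pmf (emission M s) ob * (x t s + \<delta> t ob a - 1)" "z t s ob a \<ge> 0"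
      using feas that by (auto simp: lp_feasible_def)
    have "\<delta> t ob a = 0 \<or> \<delta> t ob a = 1"
      using feas that by (auto simp: lp_feasible_def memoryless_det_def)
    then show ?thesis
      using bounds by auto
  qed
  have y: "y t s a = state_action_marginal M ?\<pi> t s a"
    if "t \<in> {1..T}" "\<And>s. x t s = state_marginal M ?\<pi> t s" for t s a
  proof -
    have "y t s a = (\<Sum>ob\<in>UNIV. z t s ob a)"
      using feas that(1) by (auto simp: lp_feasible_def)
    then show ?thesis
      by (simp only: state_action_marginal_def z[OF that(1)] that(2)
          joint_marginal_memoryless[OF \<delta> that(1)])
  qed
  have "x (Suc n) s = state_marginal M ?\<pi> (Suc n) s" if "n < T" for n s
    using that
  proof (induction n arbitrary: s)
    case 0
    then show ?case
      using feas by (simp add: lp_feasible_def state_marginal_def expectation_UNIV)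
  next
    case (Suc n)
    then have "x (Suc (Suc n)) s = (\<Sum>s0\<in>UNIV. \<Sum>a\<in>UNIV. pmf (transition M s0 a) s * y (Suc n) s0 a)"
      using feas by (auto simp: lp_feasible_def)
    then show ?case
      using Suc by (simp add: state_marginal_Suc y)
  qed
  from this[of "t - 1"] show ?thesis
    using y assms(2) by auto
qed

lemma milp_values_subset:
  fixes M :: "('s::finite, 'o::finite, 'a::finite) pomdp"
  shows "lp_values M T (memoryless_det T) \<subseteq> range (expected_reward M T)"
proof
  fix v assume "v \<in> lp_values M T (memoryless_det T)"
  then obtain x y z \<delta> where v: "v = lp_objective M T y"
    and feas: "lp_feasible M T (memoryless_det T) x y z \<delta>"
    by (auto simp: lp_values_def)
  have "v = expected_reward M T (memoryless_policy \<delta>)"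
    unfolding v expected_reward_eq_lp_objective lp_objective_def
    by (intro sum.cong refl) (simp add: det_feasible_eq_marginals[OF feas])
  then show "v \<in> range (expected_reward M T)" by blast
qed

lemma pr_values_subset:
  fixes M :: "('s::finite, 'o::finite, 'a::finite) pomdp"
  shows "range (expected_reward M T) \<subseteq> lp_values M T (memoryless T)"
  using marginals_feasible[OF averaged_policy_memoryless]
  unfolding lp_values_def expected_reward_eq_lp_objective by blast

section \<open>Existence of the maxima\<close>

text \<open>Tychonoff's theorem for sets of functions; it is applied once for each argument of a curried
  function.\<close>
lemma compact_product_space:
  assumes "\<And>i. compact (K i)"
  shows "compact {f :: 'i \<Rightarrow> 'b::topological_space. \<forall>i. f i \<in> K i}"
proof -
  have "compactin (product_topology (\<lambda>i. euclidean) UNIV) (PiE UNIV K)"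
    using assms by (simp add: compactin_PiE compactin_euclidean_iff)
  moreover have "PiE UNIV K = {f. \<forall>i. f i \<in> K i}"
    by (auto simp: PiE_def Pi_def)
  ultimately show ?thesis
    by (simp add: euclidean_product_topology compactin_euclidean_iff)
qed

definition lp_box where
  "lp_box B = {(x, y, z, \<delta>). (\<forall>t s. x t s \<in> {0..B}) \<and> (\<forall>t s a. y t s a \<in> {0..B}) \<and>
     (\<forall>t s ob a. z t s ob a \<in> {0..B}) \<and> (\<forall>t ob a. \<delta> t ob a \<in> {0..B})}"

lemma compact_lp_box:
  "compact (lp_box B :: ((nat \<Rightarrow> 's \<Rightarrow> real) \<times> (nat \<Rightarrow> 's \<Rightarrow> 'a \<Rightarrow> real) \<times>
     (nat \<Rightarrow> 's \<Rightarrow> 'o \<Rightarrow> 'a \<Rightarrow> real) \<times> (nat \<Rightarrow> 'o \<Rightarrow> 'a \<Rightarrow> real)) set)"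
proof -
  let ?X = "{x :: nat \<Rightarrow> 's \<Rightarrow> real. \<forall>t. x t \<in> {f. \<forall>s. f s \<in> {0..B}}}"
  let ?Y = "{y :: nat \<Rightarrow> 's \<Rightarrow> 'a \<Rightarrow> real. \<forall>t. y t \<in> {f. \<forall>s. f s \<in> {g. \<forall>a. g a \<in> {0..B}}}}"
  let ?Z = "{z :: nat \<Rightarrow> 's \<Rightarrow> 'o \<Rightarrow> 'a \<Rightarrow> real. \<forall>t. z t \<in>
    {f. \<forall>s. f s \<in> {g. \<forall>ob. g ob \<in> {h. \<forall>a. h a \<in> {0..B}}}}}"
  let ?D = "{d :: nat \<Rightarrow> 'o \<Rightarrow> 'a \<Rightarrow> real. \<forall>t. d t \<in> {f. \<forall>s. f s \<in> {g. \<forall>a. g a \<in> {0..B}}}}"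
  have "compact (?X \<times> ?Y \<times> ?Z \<times> ?D)"
    by (intro compact_Times compact_product_space compact_Icc)
  also have "?X \<times> ?Y \<times> ?Z \<times> ?D = lp_box B"
    by (auto simp: lp_box_def)
  finally show ?thesis .
qed

lemma continuous_on_eval:
  fixes g :: "'p::topological_space \<Rightarrow> 'i \<Rightarrow> 'b::topological_space"
    and g2 :: "'p \<Rightarrow> 'i \<Rightarrow> 'j \<Rightarrow> 'b" and g3 :: "'p \<Rightarrow> 'i \<Rightarrow> 'j \<Rightarrow> 'k \<Rightarrow> 'b"
    and g4 :: "'p \<Rightarrow> 'i \<Rightarrow> 'j \<Rightarrow> 'k \<Rightarrow> 'l \<Rightarrow> 'b"
  shows "continuous_on S g \<Longrightarrow> continuous_on S (\<lambda>p. g p i)"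
    and "continuous_on S g2 \<Longrightarrow> continuous_on S (\<lambda>p. g2 p i j)"
    and "continuous_on S g3 \<Longrightarrow> continuous_on S (\<lambda>p. g3 p i j k)"
    and "continuous_on S g4 \<Longrightarrow> continuous_on S (\<lambda>p. g4 p i j k l)"
  by (auto dest!: continuous_on_product_then_coordinatewise[where i = i]
    dest: continuous_on_product_then_coordinatewise[where i = j]
      continuous_on_product_then_coordinatewise[where i = k]
      continuous_on_product_then_coordinatewise[where i = l])

text \<open>The coordinates of \<open>(x, y, z, \<delta>)\<close>, and of a function of one or three arguments. The instances
  are fixed here since \<open>continuous_on_eval\<close> unifies with every continuity goal.\<close>
lemmas continuous_on_coords =
  continuous_on_eval(1)[OF continuous_on_id]
  continuous_on_eval(3)[OF continuous_on_id]
  continuous_on_eval(2)[OF continuous_on_fst[OF continuous_on_id]]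
  continuous_on_eval(3)[OF continuous_on_fst[OF continuous_on_snd[OF continuous_on_id]]]
  continuous_on_eval(4)[OF continuous_on_fst[OF continuous_on_snd[OF continuous_on_snd[OF continuous_on_id]]]]
  continuous_on_eval(3)[OF continuous_on_snd[OF continuous_on_snd[OF continuous_on_snd[OF continuous_on_id]]]]

lemma closed_memoryless: "closed (memoryless T)"
  unfolding memoryless_def Ball_def
  by (intro closed_Collect_all closed_Collect_imp open_Collect_const closed_Collect_conj
      closed_Collect_eq closed_Collect_le continuous_on_coords continuous_on_sum continuous_on_const)

lemma closed_memoryless_det: "closed (memoryless_det T)"
proof -
  have "closed {\<delta>. \<delta> \<in> memoryless T \<and>
     (\<forall>t. t \<in> {1..T} \<longrightarrow> (\<forall>ob a. \<delta> t ob a = 0 \<or> \<delta> t ob a = (1::real)))}"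
    using closed_memoryless
    by (intro closed_Collect_all closed_Collect_imp open_Collect_const closed_Collect_conj
        closed_Collect_disj closed_Collect_eq continuous_on_coords continuous_on_const) simp
  then show ?thesis
    by (simp add: memoryless_det_def Ball_def)
qed

lemma closed_feasible:
  fixes M :: "('s::finite, 'o::finite, 'a::finite) pomdp"
  assumes "closed D"
  shows "closed {(x, y, z, \<delta>). lp_feasible M T D x y z \<delta>}"
proof -
  have \<delta>_in_D: "closed {p :: (nat \<Rightarrow> 's \<Rightarrow> real) \<times> (nat \<Rightarrow> 's \<Rightarrow> 'a \<Rightarrow> real) \<times>
     (nat \<Rightarrow> 's \<Rightarrow> 'o \<Rightarrow> 'a \<Rightarrow> real) \<times> (nat \<Rightarrow> 'o \<Rightarrow> 'a \<Rightarrow> real). snd (snd (snd p)) \<in> D}"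
    using closed_vimage[OF assms, of "\<lambda>p. snd (snd (snd p))"]
    by (simp add: vimage_def continuous_intros)
  have "closed {p. lp_feasible M T D (fst p) (fst (snd p)) (fst (snd (snd p))) (snd (snd (snd p)))}"
    unfolding lp_feasible_def Ball_def
    by (intro closed_Collect_all closed_Collect_imp open_Collect_const closed_Collect_conj
      closed_Collect_eq closed_Collect_le \<delta>_in_D continuous_on_coords
      continuous_on_sum continuous_on_mult continuous_on_add continuous_on_diff continuous_on_const)
  then show ?thesis by (simp only: case_prod_beta' fst_conv snd_conv)
qed

text \<open>Since \<open>\<mu>\<^sup>t\<^sub>s\<^sub>o\<^sub>a \<le> \<delta>\<^sup>t\<^sub>a\<^sub>|\<^sub>o \<le> 1\<close>, every variable after the initial law is bounded by a
  number of summands, and the bound does not grow with the time. As the three cardinalities are at least 1, their product bounds all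
  variables at once.\<close>
lemma feasible_bounds:
  fixes M :: "('s::finite, 'o::finite, 'a::finite) pomdp"
  assumes feas: "lp_feasible M T D x y z \<delta>" and D: "D \<subseteq> memoryless T"
  defines "B \<equiv> real CARD('s) * real CARD('a) * real CARD('o)"
  shows "t \<in> {1..T + 1} \<Longrightarrow> x t s \<le> B" "t \<in> {1..T} \<Longrightarrow> y t s a \<le> B"
    "t \<in> {1..T} \<Longrightarrow> z t s ob a \<le> B" "t \<in> {1..T} \<Longrightarrow> \<delta> t ob a \<le> B"
proof -
  have S: "1 \<le> real CARD('s)" and A: "1 \<le> real CARD('a)" and O: "1 \<le> real CARD('o)"
    by (simp_all add: Suc_leI)
  have OB: "real CARD('o) \<le> B"
    using mult_mono[OF mult_mono[OF S A] order_refl[of "real CARD('o)"]] by (simp add: B_def)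
  have B1: "1 \<le> B"
    using O OB by linarith
  have d1: "\<delta> t ob a \<le> 1" if "t \<in> {1..T}" for t ob a
  proof -
    have m: "(\<Sum>a\<in>UNIV. \<delta> t ob a) = 1" "\<And>a. \<delta> t ob a \<ge> 0"
      using feas D that by (auto simp: lp_feasible_def memoryless_def subset_iff)
    then show ?thesis
      using member_le_sum[of a UNIV "\<delta> t ob"] by simp
  qed
  have z1: "z t s ob a \<le> 1" if "t \<in> {1..T}" for t s ob a
  proof -
    have "z t s ob a \<le> \<delta> t ob a"
      using feas that by (auto simp: lp_feasible_def)
    then show ?thesis
      using d1[OF that, of ob a] by linarith
  qed
  have y1: "y t s a \<le> real CARD('o)" "0 \<le> y t s a" if "t \<in> {1..T}" for t s a
  proof -
    have "y t s a = (\<Sum>ob\<in>UNIV. z t s ob a)"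
      using feas that by (auto simp: lp_feasible_def)
    also have "\<dots> \<le> (\<Sum>ob\<in>(UNIV::'o set). 1)"
      by (intro sum_mono z1 that)
    finally show "y t s a \<le> real CARD('o)" by simp
    show "0 \<le> y t s a"
      using feas that by (auto simp: lp_feasible_def)
  qed
  have x1: "x (t + 1) s' \<le> B" if "t \<in> {1..T}" for t s'
  proof -
    have "x (t + 1) s' = (\<Sum>s\<in>UNIV. \<Sum>a\<in>UNIV. pmf (transition M s a) s' * y t s a)"
      using feas that by (auto simp: lp_feasible_def)
    also have "\<dots> \<le> (\<Sum>s\<in>(UNIV::'s set). \<Sum>a\<in>(UNIV::'a set). 1 * real CARD('o))"
      by (intro sum_mono mult_mono y1 that) (auto simp: pmf_le_1)
    finally show ?thesis by (simp add: B_def)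
  qed
  show "x t s \<le> B" if "t \<in> {1..T + 1}"
  proof (cases "t = 1")
    case True
    have "x 1 s = pmf (init M) s"
      using feas by (simp add: lp_feasible_def)
    then show ?thesis
      using True B1 pmf_le_1[of "init M" s] by simp
  next
    case False
    then have "t - 1 \<in> {1..T}" "t - 1 + 1 = t"
      using that by auto
    then show ?thesis
      using x1 by metis
  qed
  show "t \<in> {1..T} \<Longrightarrow> y t s a \<le> B"
    using y1(1)[of t s a] OB by linarith
  show "t \<in> {1..T} \<Longrightarrow> z t s ob a \<le> B"
    using z1[of t s ob a] B1 by linarith
  show "t \<in> {1..T} \<Longrightarrow> \<delta> t ob a \<le> B"
    using d1[of t ob a] B1 by linarith
qed

lemma is_max_Sup: "v \<in> V \<Longrightarrow> (\<And>u. u \<in> V \<Longrightarrow> u \<le> v) \<Longrightarrow> is_max V (Sup V)"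
  using cSup_eq_maximum[of v V] by (auto simp: is_max_def)

lemma compact_is_max_Sup:
  assumes "compact K" "K \<noteq> {}" "continuous_on K f"
  shows "is_max (f ` K) (Sup (f ` K))"
  using continuous_attains_sup[OF assms] by (auto intro!: is_max_Sup)

lemma lp_feasible_cong:
  assumes "\<And>t. t \<in> {1..T + 1} \<Longrightarrow> x' t = x t" "\<And>t. t \<in> {1..T} \<Longrightarrow> y' t = y t"
    "\<And>t. t \<in> {1..T} \<Longrightarrow> z' t = z t" "\<And>t. t \<in> {1..T} \<Longrightarrow> \<delta>' t = \<delta> t"
    and "\<delta>' \<in> D \<longleftrightarrow> \<delta> \<in> D"
  shows "lp_feasible M T D x' y' z' \<delta>' \<longleftrightarrow> lp_feasible M T D x y z \<delta>"
proof -
  have "t \<in> {1..T} \<Longrightarrow> x' t = x t" "t \<in> {1..T} \<Longrightarrow> x' (t + 1) = x (t + 1)" "x' 1 = x 1" for t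
    using assms(1)[of t] assms(1)[of "t + 1"] assms(1)[of 1] by simp_all
  then show ?thesis
    unfolding lp_feasible_def
    by (intro arg_cong2[where f = "(\<and>)"] ball_cong arg_cong[where f = All] ext refl)
      (simp_all only: assms)
qed

text \<open>The feasible set itself is not compact, since variables at times outside the horizon are
  arbitrary. Setting them to zero keeps the point feasible and its value, so the maximum over the
  feasible points of a compact box is the maximum over all feasible points.\<close>
lemma lp_max:
  fixes M :: "('s::finite, 'o::finite, 'a::finite) pomdp"
  assumes D: "closed D" "D \<subseteq> memoryless T"
    and local: "\<And>\<delta> \<delta>'. \<delta> \<in> D \<Longrightarrow> (\<And>t. t \<in> {1..T} \<Longrightarrow> \<delta>' t = \<delta> t) \<Longrightarrow> \<delta>' \<in> D"
    and nonempty: "lp_values M T D \<noteq> {}"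
  shows "is_max (lp_values M T D) (Sup (lp_values M T D))"
proof -
  define B where "B = real CARD('s) * real CARD('a) * real CARD('o)"
  define K where "K = {(x, y, z, \<delta>). lp_feasible M T D x y z \<delta>} \<inter> lp_box B"
  let ?f = "\<lambda>p. lp_objective M T (fst (snd p))"
  have clip: "\<exists>p\<in>K. ?f p = lp_objective M T y" if feas: "lp_feasible M T D x y z \<delta>" for x y z \<delta>
  proof -
    define x' where "x' t = (if t \<in> {1..T + 1} then x t else (\<lambda>_. 0))" for t
    define y' where "y' t = (if t \<in> {1..T} then y t else (\<lambda>_ _. 0))" for t
    define z' where "z' t = (if t \<in> {1..T} then z t else (\<lambda>_ _ _. 0))" for t
    define \<delta>' where "\<delta>' t = (if t \<in> {1..T} then \<delta> t else (\<lambda>_ _. 0))" for t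
    have eqs: "t \<in> {1..T + 1} \<Longrightarrow> x' t = x t" "t \<in> {1..T} \<Longrightarrow> y' t = y t"
      "t \<in> {1..T} \<Longrightarrow> z' t = z t" "t \<in> {1..T} \<Longrightarrow> \<delta>' t = \<delta> t" for t
      by (auto simp: x'_def y'_def z'_def \<delta>'_def)
    have "\<delta> \<in> D"
      using feas by (simp only: lp_feasible_def)
    moreover from this have "\<delta>' \<in> D"
      by (rule local) (rule eqs(4))
    ultimately have "lp_feasible M T D x' y' z' \<delta>' = lp_feasible M T D x y z \<delta>"
      by (intro lp_feasible_cong) (simp_all only: eqs)
    then have feas': "lp_feasible M T D x' y' z' \<delta>'"
      using feas by blast
    have nonneg: "0 \<le> B"
      by (simp add: B_def)
    note bounds = feasible_bounds[OF feas D(2), folded B_def]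
    have pos: "t \<in> {1..T + 1} \<Longrightarrow> 0 \<le> x t s" "t \<in> {1..T} \<Longrightarrow> 0 \<le> y t s a"
      "t \<in> {1..T} \<Longrightarrow> 0 \<le> z t s ob a" "t \<in> {1..T} \<Longrightarrow> 0 \<le> \<delta> t ob a" for t s ob a
      using feas D(2) by (auto simp: lp_feasible_def memoryless_def)
    have "x' t s \<in> {0..B}" "y' t s a \<in> {0..B}" "z' t s ob a \<in> {0..B}" "\<delta>' t ob a \<in> {0..B}"
      for t s ob a
      using bounds pos nonneg by (auto simp: x'_def y'_def z'_def \<delta>'_def)
    then have "(x', y', z', \<delta>') \<in> K"
      using feas' by (simp add: K_def lp_box_def)
    moreover have "lp_objective M T y' = lp_objective M T y"
      unfolding lp_objective_def by (intro sum.cong refl) (simp add: eqs)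
    ultimately show ?thesis
      by (intro bexI[of _ "(x', y', z', \<delta>')"]) simp_all
  qed
  have image: "lp_values M T D = ?f ` K"
  proof
    show "lp_values M T D \<subseteq> ?f ` K"
    proof
      fix v assume "v \<in> lp_values M T D"
      then obtain x y z \<delta> where "v = lp_objective M T y" "lp_feasible M T D x y z \<delta>"
        unfolding lp_values_def by blast
      then show "v \<in> ?f ` K"
        using clip by (metis image_eqI)
    qed
    show "?f ` K \<subseteq> lp_values M T D"
      unfolding K_def lp_values_def by fastforce
  qed
  have "compact K"
    unfolding K_def by (intro closed_Int_compact closed_feasible D(1) compact_lp_box)
  moreover have "continuous_on K ?f"
    unfolding lp_objective_def
    by (intro continuous_on_coords continuous_on_sum continuous_on_mult continuous_on_const)
  ultimately show ?thesis
    using nonempty unfolding image by (intro compact_is_max_Sup) auto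
qed

text \<open>The payoff \<open>g\<close> may depend on the parameter as well: this is what makes the induction work, as
  one step of the recursion moves action probabilities from the law into the payoff.\<close>
lemma continuous_law_expectation:
  fixes M :: "('s::finite, 'o::finite, 'a::finite) pomdp"
    and \<pi> :: "'b::topological_space \<Rightarrow> ('o, 'a) pr_policy"
  assumes "\<And>h ob a. continuous_on K (\<lambda>f. pmf (\<pi> f h ob) a)"
    and "\<And>w. continuous_on K (\<lambda>f. g f w)"
  shows "continuous_on K (\<lambda>f. law_expectation M (\<pi> f) n (g f))"
  using assms(2)
proof (induction n arbitrary: g)
  case 0
  then show ?case
    by (simp add: expectation_UNIV continuous_intros)
next
  case (Suc n)
  show ?case
    unfolding law_expectation_Suc
    by (intro Suc.IH continuous_intros assms(1) Suc.prems)
qed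

text \<open>Policies are represented by their probabilities, for which a product topology is available.
  All histories are kept, of whatever length; infinitely many factors do not harm compactness.\<close>
lemma pr_max:
  fixes M :: "('s::finite, 'o::finite, 'a::finite) pomdp"
  shows "is_max (range (expected_reward M T)) (Sup (range (expected_reward M T)))"
proof -
  define K :: "(('o \<times> 'a) list \<Rightarrow> 'o \<Rightarrow> 'a \<Rightarrow> real) set"
    where "K = {f. \<forall>h ob. stochastic (f h ob)}"
  let ?\<pi> = "\<lambda>f h ob. embed_pmf (f h ob)"
  let ?f = "\<lambda>f. expected_reward M T (?\<pi> f)"
  have pmf: "pmf (?\<pi> f h ob) a = f h ob a" if "f \<in> K" for f h ob a
    using that by (simp add: K_def pmf_embed_stochastic)
  have K_pmf: "(\<lambda>h ob. pmf (\<pi> h ob)) \<in> K" for \<pi> :: "('o, 'a) pr_policy"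
    by (simp add: K_def stochastic_def sum_pmf_eq_1)
  have "compact K"
  proof -
    have "closed {p :: 'a \<Rightarrow> real. stochastic p}"
      unfolding stochastic_def
      by (intro closed_Collect_all closed_Collect_conj closed_Collect_eq closed_Collect_le
          continuous_on_coords continuous_on_sum continuous_on_const)
    moreover have "compact {p :: 'a \<Rightarrow> real. \<forall>a. p a \<in> {0..1}}"
      by (intro compact_product_space compact_Icc)
    ultimately have "compact ({p :: 'a \<Rightarrow> real. stochastic p} \<inter> {p. \<forall>a. p a \<in> {0..1}})"
      by (rule closed_Int_compact)
    also have "{p :: 'a \<Rightarrow> real. stochastic p} \<inter> {p. \<forall>a. p a \<in> {0..1}} = {p. stochastic p}"
    proof -
      have "p a \<le> 1" if "stochastic p" for p :: "'a \<Rightarrow> real" and a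
        using that member_le_sum[of a UNIV p] by (simp add: stochastic_def)
      then show ?thesis by (auto simp: stochastic_def)
    qed
    finally have "compact {p :: 'a \<Rightarrow> real. stochastic p}" .
    then have "compact {f :: ('o \<times> 'a) list \<Rightarrow> 'o \<Rightarrow> 'a \<Rightarrow> real.
        \<forall>h. f h \<in> {g. \<forall>ob. g ob \<in> {p. stochastic p}}}"
      by (intro compact_product_space)
    then show ?thesis by (simp add: K_def)
  qed
  moreover have "K \<noteq> {}"
    using K_pmf by blast
  moreover have "continuous_on K ?f"
    unfolding expected_reward_def
  proof (rule continuous_law_expectation)
    show "continuous_on K (\<lambda>f. pmf (?\<pi> f h ob) a)" for h ob a
      by (subst continuous_on_cong[OF refl pmf]) (assumption, rule continuous_on_coords)
  qed (rule continuous_on_const)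
  ultimately have "is_max (?f ` K) (Sup (?f ` K))"
    by (rule compact_is_max_Sup)
  moreover have "?f ` K = range (expected_reward M T)"
  proof -
    have "expected_reward M T \<pi> = ?f (\<lambda>h ob. pmf (\<pi> h ob))" for \<pi>
    proof -
      have "embed_pmf (pmf p) = p" for p :: "'a pmf"
        by (rule pmf_eqI) (simp add: pmf_embed_stochastic stochastic_def sum_pmf_eq_1)
      then show ?thesis by simp
    qed
    then have "range (expected_reward M T) \<subseteq> ?f ` K"
      using K_pmf by (metis image_eqI image_subsetI)
    then show ?thesis by blast
  qed
  ultimately show ?thesis by simp
qed

text \<open>A policy that always plays the same action has an averaged policy with values 0 and 1, so its
  marginals satisfy the integer program.\<close>
lemma milp_values_nonempty:
  fixes M :: "('s::finite, 'o::finite, 'a::finite) pomdp"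
  shows "lp_values M T (memoryless_det T) \<noteq> {}"
proof -
  fix a0 :: 'a
  let ?\<pi> = "\<lambda>h ob. return_pmf a0"
  have "averaged_policy M ?\<pi> t ob a \<in> {0, 1}" for t ob a
    by (simp add: averaged_policy_def indicator_def)
  then have "averaged_policy M ?\<pi> \<in> memoryless_det T"
    using averaged_policy_memoryless[of M ?\<pi> T] by (auto simp: memoryless_det_def)
  from marginals_feasible[OF this] show ?thesis
    unfolding lp_values_def by blast
qed

section \<open>Comparison of the optimal values\<close>

theorem theorem2:
  fixes M :: "('s::finite, 'o::finite, 'a::finite) pomdp" and T :: nat
  shows "is_max (lp_values M T (memoryless_det T)) (milp_opt M T) \<and>
         is_max (range (expected_reward M T)) (pr_opt M T) \<and>
         is_max (lp_values M T (memoryless T)) (relaxation_opt M T) \<and>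
         milp_opt M T \<le> pr_opt M T \<and> pr_opt M T \<le> relaxation_opt M T"
proof -
  have milp: "is_max (lp_values M T (memoryless_det T)) (milp_opt M T)"
    unfolding milp_opt_def
    by (intro lp_max closed_memoryless_det milp_values_nonempty)
      (auto simp: memoryless_det_def memoryless_def)
  have relaxation: "is_max (lp_values M T (memoryless T)) (relaxation_opt M T)"
    unfolding relaxation_opt_def using pr_values_subset[of M T]
    by (intro lp_max closed_memoryless) (auto simp: memoryless_def)
  have pr: "is_max (range (expected_reward M T)) (pr_opt M T)"
    unfolding pr_opt_def by (rule pr_max)
  have mono: "u \<le> v" if "is_max U u" "is_max V v" "U \<subseteq> V" for U V u v
    using that by (auto simp: is_max_def)
  show ?thesis
    using milp relaxation pr mono[OF milp pr milp_values_subset] mono[OF pr relaxation pr_values_subset]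
    by blast
qed

end
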